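(* For all real $q$ with $|q|<1$ and all real $x$ with $|x|\leq 2/\sqrt{1-q}$, $$f_{H}(x|q)=\frac{\sqrt{1-q}}{2\pi}\sqrt{4-(1-q)x^{2}}\,\sum_{k=1}^{\infty}(-1)^{k-1}q^{\binom{k}{2}}\,U_{2k-2}\!\left(\frac{x\sqrt{1-q}}{2}\right).$$
   Context: For $q\in(-1,1)$ the $q$-Gaussian density is $$f_{H}(x|q)=\frac{\sqrt{1-q}}{2\pi\sqrt{4-(1-q)x^{2}}}\prod_{k=0}^{\infty}\left((1+q^{k})^{2}-(1-q)x^{2}q^{k}\right)\prod_{k=0}^{\infty}(1-q^{k+1}),\qquad |x|\leq \frac{2}{\sqrt{1-q}}.$$ At the endpoints $x=\pm 2/\sqrt{1-q}$ (where the formula reads $0/0$) the value is understood as the continuous extension, i.e. $0$. The convention $q^{0}=1$ is used also for $q=0$. $U_n$ ($n\ge -1$) is the Chebyshev polynomial of the second kind, $U_n(\cos\theta)=\sin((n+1)\theta)/\sin\theta$. $\binom{n}{k}=\frac{n!}{k!(n-k)!}$ is the ordinary binomial coefficient, with $\binom{1}{2}=0$ (so $\binom{k}{2}=k(k-1)/2$). *)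

theory Defs
  imports "HOL-Analysis.Analysis" "HOL-Computational_Algebra.Polynomial"
begin

definition cheb_U :: "nat \<Rightarrow> real poly" where
  "cheb_U n = (THE p. \<forall>\<theta>. sin \<theta> \<noteq> 0 \<longrightarrow> poly p (cos \<theta>) = sin ((real n + 1) * \<theta>) / sin \<theta>)"

text \<open>The trigonometric identity determines a unique polynomial; the witness is the one given
  by the three-term recurrence.\<close>

fun cheb_U_rec :: "nat \<Rightarrow> real poly" where
  "cheb_U_rec 0 = 1"
| "cheb_U_rec (Suc 0) = [:0, 2:]"
| "cheb_U_rec (Suc (Suc n)) = [:0, 2:] * cheb_U_rec (Suc n) - cheb_U_rec n"

lemma cheb_U_rec_cos_sin:
  "poly (cheb_U_rec n) (cos \<theta>) * sin \<theta> = sin ((real n + 1) * \<theta>)"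
proof (induction n rule: cheb_U_rec.induct)
  case 1
  show ?case by simp
next
  case 2
  show ?case by (simp add: sin_double)
next
  case (3 n)
  define a where "a = (real n + 2) * \<theta>"
  have a: "(real (Suc n) + 1) * \<theta> = a" "(real n + 1) * \<theta> = a - \<theta>"
    "(real (Suc (Suc n)) + 1) * \<theta> = a + \<theta>"
    by (simp_all add: a_def algebra_simps)
  have "poly (cheb_U_rec (Suc (Suc n))) (cos \<theta>) * sin \<theta> =
      2 * cos \<theta> * (poly (cheb_U_rec (Suc n)) (cos \<theta>) * sin \<theta>) -
      poly (cheb_U_rec n) (cos \<theta>) * sin \<theta>"
    by (simp add: algebra_simps)
  also have "\<dots> = 2 * cos \<theta> * sin a - sin (a - \<theta>)"
    by (simp only: 3 a)
  also have "\<dots> = sin (a + \<theta>)"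
    by (simp add: sin_add sin_diff)
  finally show ?case
    by (simp only: a)
qed

lemma cheb_U_unique:
  assumes "\<And>\<theta>. sin \<theta> \<noteq> 0 \<Longrightarrow> poly p (cos \<theta>) = poly r (cos \<theta>)"
  shows "p = (r :: real poly)"
proof (rule ccontr)
  assume "p \<noteq> r"
  then have "finite {x. poly (p - r) x = 0}"
    by (intro poly_roots_finite) simp
  moreover have "{-1<..<1} \<subseteq> {x. poly (p - r) x = 0}"
  proof
    fix x :: real
    assume x: "x \<in> {-1<..<1}"
    then have "x\<^sup>2 < 1"
      by (simp add: abs_square_less_1 abs_less_iff)
    then have "sin (arccos x) \<noteq> 0"
      using x by (simp add: sin_arccos)
    from assms[OF this] show "x \<in> {x. poly (p - r) x = 0}"
      using x by simp
  qed
  ultimately have "finite {-1<..<1 :: real}"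
    by (rule finite_subset[rotated])
  then show False
    using infinite_Ioo[of "-1 :: real" 1] by simp
qed

lemma cheb_U_eq_rec: "cheb_U n = cheb_U_rec n"
  unfolding cheb_U_def
proof (rule the_equality)
  show "\<forall>\<theta>. sin \<theta> \<noteq> 0 \<longrightarrow> poly (cheb_U_rec n) (cos \<theta>) = sin ((real n + 1) * \<theta>) / sin \<theta>"
    by (simp flip: cheb_U_rec_cos_sin)
  then show "p = cheb_U_rec n"
    if "\<forall>\<theta>. sin \<theta> \<noteq> 0 \<longrightarrow> poly p (cos \<theta>) = sin ((real n + 1) * \<theta>) / sin \<theta>" for p
    using that by (intro cheb_U_unique) simp
qed

lemma cheb_U_cos:
  "sin \<theta> \<noteq> 0 \<Longrightarrow> poly (cheb_U n) (cos \<theta>) = sin ((real n + 1) * \<theta>) / sin \<theta>"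
  by (simp add: cheb_U_eq_rec flip: cheb_U_rec_cos_sin)

text \<open>The \<open>else\<close> branch covers the two endpoints, where the formula reads 0/0 and its continuous
  extension is 0; it also makes the density vanish outside its support.  Since
  \<open>0 ^ 0 = 1\<close>, the case \<open>q = 0\<close> needs no special treatment.\<close>

definition q_gaussian_density :: "real \<Rightarrow> real \<Rightarrow> real" where
  "q_gaussian_density q x =
     (if \<bar>x\<bar> < 2 / sqrt (1 - q) then
        sqrt (1 - q) / (2 * pi * sqrt (4 - (1 - q) * x\<^sup>2))
        * (\<Prod>k. (1 + q ^ k)\<^sup>2 - (1 - q) * x\<^sup>2 * q ^ k)
        * (\<Prod>k. 1 - q ^ (k + 1))
      else 0)"

end

theory Submission
  imports Defs
begin

text \<open>Put \<open>x * sqrt (1 - q) = 2 * cos t\<close>. The density becomes a multiple of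
  \<open>sin t * (\<Prod>k\<ge>1. (1 - q^k) * (1 - 2 * q^k * cos (2 * t) + q^(2 * k)))\<close>, and the claim is
  the Jacobi triple product identity. It is the limit of a finite version whose coefficients are
  the Gaussian binomials \<open>[2n+1 choose n-k]\<^sub>q\<close>; these are bounded uniformly in \<open>n\<close> and \<open>k\<close>, so
  Tannery's theorem justifies the passage to the limit.\<close>

section \<open>The q-Pochhammer symbols (q; q)_n and the odd-row Gaussian binomials\<close>

definition q_fact :: "'a::comm_ring_1 \<Rightarrow> nat \<Rightarrow> 'a" where
  "q_fact q n = (\<Prod>i<n. 1 - q ^ Suc i)"

lemma q_fact_0 [simp]: "q_fact q 0 = 1"
  and q_fact_Suc: "q_fact q (Suc n) = q_fact q n * (1 - q ^ Suc n)"
  by (simp_all add: q_fact_def)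

text \<open>The symmetry [2n+1 choose n-k] = [2n+1 choose n+k+1] exchanges k with -k-1, so indices k
  \<ge> 0 carry all the information. The value 0 for k > n is set by hand, since
  \<open>n - k\<close> would truncate to 0.\<close>

definition central_q_binomial :: "'a::field \<Rightarrow> nat \<Rightarrow> nat \<Rightarrow> 'a" where
  "central_q_binomial q n k =
     (if k \<le> n then q_fact q (2 * n + 1) / (q_fact q (n - k) * q_fact q (n + k + 1)) else 0)"

lemma abs_power_Suc_less_one:
  fixes q :: real
  assumes "\<bar>q\<bar> < 1"
  shows "\<bar>q ^ Suc i\<bar> < 1"
  unfolding power_abs using assms by (simp add: power_less_one_iff del: power_Suc)

lemma one_minus_power_pos:
  fixes q :: real
  assumes "\<bar>q\<bar> < 1"
  shows "0 < 1 - q ^ Suc n"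
  using abs_power_Suc_less_one[OF assms, of n] by linarith

lemma q_fact_pos:
  fixes q :: real
  assumes "\<bar>q\<bar> < 1"
  shows "0 < q_fact q n"
  unfolding q_fact_def using one_minus_power_pos[OF assms] by (intro prod_pos) blast

lemma central_q_binomial_diag:
  fixes q :: real
  assumes "\<bar>q\<bar> < 1"
  shows "central_q_binomial q n n = 1"
  using q_fact_pos[OF assms, of "Suc (2 * n)"]
  by (simp add: central_q_binomial_def mult_2)

text \<open>A common factor of the neighbouring coefficients; dividing by it turns their recurrence
  into a polynomial identity in \<open>q\<close>, \<open>q^j\<close> and \<open>q^k\<close>.\<close>

definition q_binomial_kernel :: "'a::field \<Rightarrow> nat \<Rightarrow> nat \<Rightarrow> 'a" where
  "q_binomial_kernel q n k = q_fact q (2 * n + 1) / (q_fact q (Suc n - k) * q_fact q (n + k + 2))"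

text \<open>Cancellation in quotients of q-Pochhammer symbols. The range extends to k = n + 1:
  wherever a coefficient is 0 by default, truncated subtraction supplies a factor 1 - q^0 =
  0.\<close>

lemma central_q_binomial_kernel:
  fixes q :: real
  assumes q: "\<bar>q\<bar> < 1" and k: "k \<le> Suc n"
  shows "central_q_binomial q (Suc n) k =
      q_binomial_kernel q n k * (1 - q ^ (2 * n + 2)) * (1 - q ^ (2 * n + 3))" (is ?A)
    and "central_q_binomial q n k =
      q_binomial_kernel q n k * (1 - q ^ (Suc n - k)) * (1 - q ^ (n + k + 2))" (is ?B)
    and "central_q_binomial q n (Suc k) =
      q_binomial_kernel q n k * (1 - q ^ (Suc n - k)) * (1 - q ^ (n - k))" (is ?C)
proof -
  have nz: "q_fact q m \<noteq> 0" "1 - q ^ Suc m \<noteq> 0" for m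
    using q_fact_pos[OF q, of m] one_minus_power_pos[OF q, of m] by linarith+
  have "2 * Suc n + 1 = Suc (Suc (2 * n + 1))" "Suc n + k + 1 = n + k + 2"
    by simp_all
  with k show ?A
    by (simp only: central_q_binomial_def q_binomial_kernel_def q_fact_Suc) (simp add: eval_nat_numeral)
  have "q_fact q (n + k + 2) = q_fact q (n + k + 1) * (1 - q ^ (n + k + 2))"
    "1 - q ^ (n + k + 2) \<noteq> 0"
    using q_fact_Suc[of q "n + k + 1"] nz(2)[of "n + k + 1"] by simp_all
  note upper = this
  have cancel: "z / (a * b) = z / (a * c * (b * d)) * c * d" if "c \<noteq> 0" "d \<noteq> 0" for z a b c d :: real
    using that by simp
  show ?B
  proof (cases "k = Suc n")
    case True
    then show ?thesis by (simp add: central_q_binomial_def)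
  next
    case False
    then have "k \<le> n" "Suc n - k = Suc (n - k)" using k by auto
    then show ?thesis
      using upper nz[of "n - k"]
      by (simp only: central_q_binomial_def q_binomial_kernel_def q_fact_Suc[of q "n - k"] if_True)
        (rule cancel)
  qed
  show ?C
  proof (cases "Suc k \<le> n")
    case False
    then have "k = n \<or> k = Suc n" using k by auto
    then show ?thesis by (auto simp: central_q_binomial_def)
  next
    case True
    then obtain j where n: "n = Suc k + j"
      using le_Suc_ex by blast
    have "n - k = Suc j" "Suc n - k = Suc (Suc j)" "n - Suc k = j" "n + Suc k + 1 = n + k + 2"
      using n by auto
    then show ?thesis
      using True nz(1)[of j] nz(2)[of j] nz(2)[of "Suc j"]
      by (simp only: central_q_binomial_def q_binomial_kernel_def q_fact_Suc if_True)
        (simp add: divide_simps)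
  qed
qed

text \<open>The boundary case of the recurrence below: by symmetry the neighbour at index -1 equals
  the coefficient at 0, whence the extra term \<open>q ^ Suc n\<close>.\<close>

lemma central_q_binomial_rec_0:
  fixes q :: real
  assumes q: "\<bar>q\<bar> < 1"
  shows "central_q_binomial q (Suc n) 0 =
    (1 + (q ^ Suc n)\<^sup>2 + q ^ Suc n) * central_q_binomial q n 0
    + q ^ Suc n * q * central_q_binomial q n 1"
proof -
  define D u where "D = q_binomial_kernel q n 0" and "u = q ^ n"
  have "q ^ (2 * n + 2) = u * u * q * q" "q ^ (2 * n + 3) = u * u * q * q * q"
    "q ^ (n + 0 + 2) = u * q * q" "q ^ (Suc n - 0) = u * q" "q ^ (n - 0) = u" "q ^ Suc n = u * q"
    by (simp_all add: u_def power_add mult_2 eval_nat_numeral)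
  note pow = this
  show ?thesis
    unfolding One_nat_def central_q_binomial_kernel[OF q le0, of n] D_def[symmetric] pow
    by (simp add: algebra_simps power2_eq_square)
qed

text \<open>The shape is that of two successive q-Pascal rules, leading from row 2n+1 to row 2n+3.
  For k < n it is checked as a polynomial identity after writing every coefficient as a multiple of
  one kernel.\<close>

lemma central_q_binomial_rec_Suc:
  fixes q :: real
  assumes q: "\<bar>q\<bar> < 1" and k: "k \<le> n"
  shows "central_q_binomial q (Suc n) (Suc k) =
    (1 + (q ^ Suc n)\<^sup>2) * central_q_binomial q n (Suc k)
    + q ^ (n - k) * central_q_binomial q n k
    + q ^ (n + k + 3) * central_q_binomial q n (Suc (Suc k))"
proof (cases "k = n")
  case True
  then show ?thesis
    by (simp only: central_q_binomial_diag[OF q]) (simp add: central_q_binomial_def)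
next
  case False
  \<comment> \<open>This form of n removes truncated subtraction from all exponents.\<close>
  then obtain j where n: "n = Suc k + j"
    using k le_Suc_ex[of "Suc k" n] by auto
  define D u v where "D = q_binomial_kernel q n (Suc k)" and "u = q ^ j" and "v = q ^ k"
  have nz: "q_fact q m \<noteq> 0" "1 - q ^ Suc m \<noteq> 0" for m
    using q_fact_pos[OF q, of m] one_minus_power_pos[OF q, of m] by linarith+
  have "n - k = Suc n - Suc k" "n + Suc k + 2 = Suc (Suc (n + k + 1))"
    by simp_all
  \<comment> \<open>The lower neighbour is out of reach of the kernel lemma at \<open>Suc k\<close>,
    so it is computed directly.\<close>
  then have "central_q_binomial q n k = D * (1 - q ^ (n + k + 2)) * (1 - q ^ (n + k + 3))"
    using k nz(1)[of "n + k + 1"] nz(1)[of "n - k"] nz(2)[of "n + k + 1"] nz(2)[of "n + k + 2"]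
    unfolding D_def q_binomial_kernel_def
    by (simp only: central_q_binomial_def q_binomial_kernel_def q_fact_Suc if_True)
      (simp add: divide_simps eval_nat_numeral)
  note low = this
  have "Suc k \<le> Suc n" using k by simp
  note ker = central_q_binomial_kernel[OF q this, folded D_def]
  have "q ^ (2 * n + 2) = u * u * v * v * q * q * q * q"
    "q ^ (2 * n + 3) = u * u * v * v * q * q * q * q * q"
    "q ^ (n + Suc k + 2) = u * v * v * q * q * q * q"
    "q ^ (n + k + 3) = u * v * v * q * q * q * q"
    "q ^ (n + k + 2) = u * v * v * q * q * q"
    "q ^ (Suc n - Suc k) = u * q" "q ^ (n - k) = u * q" "q ^ (n - Suc k) = u"
    "q ^ Suc n = u * v * q * q"
    by (simp_all add: n u_def v_def power_add mult_2 eval_nat_numeral)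
  note pow = this
  show ?thesis
    unfolding low ker pow by (simp add: algebra_simps power2_eq_square)
qed

section \<open>The finite triple product\<close>

lemma Suc_choose_two: "Suc (Suc k) choose 2 = (Suc k choose 2) + Suc k"
  by (simp add: numeral_2_eq_2)

text \<open>Summation by parts: a three-term recurrence moves from the coefficients \<open>a\<close>
  to the sequence \<open>s\<close>. Both are extended oddly, with value at -1 minus the value at 0;
  only boundary terms at the upper end remain.\<close>

lemma sum_three_term_telescope:
  fixes a b s :: "nat \<Rightarrow> 'a::comm_ring"
  assumes "b 0 = P * a 0 + Q * a 0 - Q * a 1"
    and "\<And>k. k < N \<Longrightarrow> b (Suc k) = P * a (Suc k) - Q * a k - Q * a (Suc (Suc k))"
  shows "(\<Sum>k\<le>N. b k * s k) =
    (\<Sum>k\<le>N. a k * (P * s k - Q * s (Suc k) - Q * (case k of 0 \<Rightarrow> - s 0 | Suc j \<Rightarrow> s j)))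
    + Q * (a N * s (Suc N) - a (Suc N) * s N)" (is "?L N = ?R N")
  using assms(2)
proof (induction N)
  case 0
  show ?case by (simp add: assms(1) algebra_simps)
next
  case (Suc N)
  have b: "b (Suc N) = P * a (Suc N) - Q * a N - Q * a (Suc (Suc N))"
    using Suc.prems by simp
  have IH: "?L N = ?R N"
    by (intro Suc.IH Suc.prems) simp
  show ?case
    unfolding sum.atMost_Suc IH b by (simp add: algebra_simps)
qed

text \<open>Induction on n. By 2 cos(2t) sin y = sin(y + 2t) + sin(y - 2t), the new factor shifts
  the sine index by one in both directions, which matches the recurrence of the
  coefficients.\<close>

lemma finite_triple_product:
  fixes q t :: real
  assumes q: "\<bar>q\<bar> < 1"
  shows "sin t * (\<Prod>i<n. 1 - 2 * q ^ Suc i * cos (2 * t) + (q ^ Suc i)\<^sup>2) =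
    (\<Sum>k\<le>n. (-1) ^ k * q ^ (Suc k choose 2) * central_q_binomial q n k * sin ((2 * real k + 1) * t))"
proof (induction n)
  case 0
  show ?case by (simp add: central_q_binomial_diag[OF q] numeral_2_eq_2)
next
  case (Suc n)
  define Q where "Q = q ^ Suc n"
  define a where "a m k = (-1) ^ k * q ^ (Suc k choose 2) * central_q_binomial q m k" for m k
  define s where "s k = sin ((2 * real k + 1) * t)" for k
  have a_zero: "a n (Suc n) = 0" "a n (Suc (Suc n)) = 0"
    by (simp_all add: a_def central_q_binomial_def)
  have a_0: "a (Suc n) 0 = (1 + Q\<^sup>2) * a n 0 + Q * a n 0 - Q * a n 1"
    using central_q_binomial_rec_0[OF q, of n]
    by (simp add: a_def Q_def numeral_2_eq_2 algebra_simps)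
  have a_Suc: "a (Suc n) (Suc k) = (1 + Q\<^sup>2) * a n (Suc k) - Q * a n k - Q * a n (Suc (Suc k))"
    if "k < Suc n" for k
  proof -
    define e X W where "e = q ^ (Suc k choose 2)" and "X = q ^ Suc k" and "W = q ^ Suc (Suc k)"
    \<comment> \<open>The growth of the exponent \<open>Suc k choose 2\<close> absorbs the powers of
      q that depend on k, so the weighted coefficients satisfy a recurrence with constants 1 + Q^2
      and Q.\<close>
    have XY: "X * q ^ (n - k) = Q"
      using that unfolding Q_def X_def by (simp flip: power_add power_Suc)
    have XZ: "X * q ^ (n + k + 3) = Q * (X * W)"
      unfolding Q_def X_def W_def power_add[symmetric]
      by (rule arg_cong[of _ _ "power q"]) simp
    have choose: "q ^ (Suc (Suc k) choose 2) = e * X"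
      "q ^ (Suc (Suc (Suc k)) choose 2) = e * (X * W)"
      unfolding e_def X_def W_def by (simp_all only: Suc_choose_two power_add mult.assoc)
    have expand: "(-1) ^ Suc k * (e * X) * (P * c1 + Y * c0 + Z * c2) =
        (-1) ^ Suc k * e * (P * X * c1 + (X * Y) * c0 + (X * Z) * c2)" for P Y Z c0 c1 c2
      by (simp add: algebra_simps)
    have "k \<le> n"
      using that by simp
    show ?thesis
      unfolding a_def e_def[symmetric] choose central_q_binomial_rec_Suc[OF q \<open>k \<le> n\<close>]
        Q_def[symmetric] expand XY XZ
      by (simp add: algebra_simps)
  qed
  \<comment> \<open>At k = 0 the lower neighbour is sin(-t), which is the odd extension - s
    0.\<close>
  have step: "(1 - 2 * Q * cos (2 * t) + Q\<^sup>2) * s k =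
    (1 + Q\<^sup>2) * s k - Q * s (Suc k) - Q * (case k of 0 \<Rightarrow> - s 0 | Suc j \<Rightarrow> s j)" for k
  proof -
    define y where "y = (2 * real k + 1) * t"
    have "s k = sin y" "s (Suc k) = sin (y + 2 * t)"
      by (simp_all add: s_def y_def algebra_simps)
    moreover have "(case k of 0 \<Rightarrow> - s 0 | Suc j \<Rightarrow> s j) = sin (y - 2 * t)"
    proof (cases k)
      case 0
      have "sin (t - 2 * t) = - sin t" by simp
      with 0 show ?thesis by (simp only: y_def s_def nat.case) simp
    qed (simp add: s_def y_def algebra_simps)
    ultimately show ?thesis
      by (simp only: sin_add sin_diff) (simp add: algebra_simps)
  qed
  have "sin t * (\<Prod>i<Suc n. 1 - 2 * q ^ Suc i * cos (2 * t) + (q ^ Suc i)\<^sup>2) =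
      (1 - 2 * Q * cos (2 * t) + Q\<^sup>2) * (\<Sum>k\<le>n. a n k * s k)"
    using Suc.IH unfolding a_def s_def Q_def by (simp add: mult.commute mult.left_commute)
  \<comment> \<open>A zero term is appended so that the range fits row n + 1; the upper boundary
    terms of the telescoping vanish for the same reason.\<close>
  also have "\<dots> = (1 - 2 * Q * cos (2 * t) + Q\<^sup>2) * (\<Sum>k\<le>Suc n. a n k * s k)"
    by (simp add: a_zero)
  also have "\<dots> = (\<Sum>k\<le>Suc n. a n k * ((1 - 2 * Q * cos (2 * t) + Q\<^sup>2) * s k))"
    by (simp only: sum_distrib_left mult.left_commute)
  also have "\<dots> = (\<Sum>k\<le>Suc n. a (Suc n) k * s k)"
    unfolding step
    by (subst sum_three_term_telescope[where a = "a n" and P = "1 + Q\<^sup>2" and Q = Q])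
      (simp_all only: a_0 a_Suc a_zero, simp)
  finally show ?case by (simp add: a_def s_def)
qed

section \<open>Convergence, uniform bounds and passage to the limit\<close>

lemma theta_factor_bounds:
  fixes r t :: real
  assumes "\<bar>r\<bar> < 1"
  shows "0 < 1 - 2 * r * cos (2 * t) + r\<^sup>2" and "\<bar>- 2 * r * cos (2 * t) + r\<^sup>2\<bar> \<le> 3 * \<bar>r\<bar>"
proof -
  have *: "\<bar>r * cos (2 * t)\<bar> \<le> \<bar>r\<bar>"
    by (simp add: abs_mult mult_left_le)
  \<comment> \<open>The factor is the squared modulus of 1 - r exp(2it), hence at least (1 -
    |r|)^2.\<close>
  have "0 < (1 - \<bar>r\<bar>)\<^sup>2"
    using assms by simp
  also have "(1 - \<bar>r\<bar>)\<^sup>2 \<le> 1 - 2 * r * cos (2 * t) + r\<^sup>2"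
    using * by (simp add: power2_diff)
  finally show "0 < 1 - 2 * r * cos (2 * t) + r\<^sup>2" .
  have "r\<^sup>2 \<le> \<bar>r\<bar>"
    using assms mult_left_le[of "\<bar>r\<bar>" "\<bar>r\<bar>"] by (simp add: power2_eq_square)
  with * show "\<bar>- 2 * r * cos (2 * t) + r\<^sup>2\<bar> \<le> 3 * \<bar>r\<bar>"
    unfolding abs_le_iff using zero_le_power2[of r] by linarith
qed

lemma convergent_prod_theta:
  fixes q t :: real
  assumes q: "\<bar>q\<bar> < 1"
  shows "convergent_prod (\<lambda>i. 1 - 2 * q ^ Suc i * cos (2 * t) + (q ^ Suc i)\<^sup>2)"
proof -
  note bounds = theta_factor_bounds[OF abs_power_Suc_less_one[OF q]]
  have "summable (\<lambda>i. 3 * \<bar>q\<bar> * \<bar>q\<bar> ^ i)"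
    using q by (intro summable_mult summable_geometric) simp
  then have "summable (\<lambda>i. \<bar>- 2 * q ^ Suc i * cos (2 * t) + (q ^ Suc i)\<^sup>2\<bar>)"
  proof (rule summable_comparison_test[rotated], intro exI allI impI)
    show "norm \<bar>- 2 * q ^ Suc i * cos (2 * t) + (q ^ Suc i)\<^sup>2\<bar> \<le> 3 * \<bar>q\<bar> * \<bar>q\<bar> ^ i" for i
      using bounds(2)[of i t] by (simp add: abs_mult power_abs)
  qed
  then have "convergent_prod (\<lambda>i. 1 + (- 2 * q ^ Suc i * cos (2 * t) + (q ^ Suc i)\<^sup>2))"
  proof (rule summable_imp_convergent_prod_real)
    show "- 2 * q ^ Suc i * cos (2 * t) + (q ^ Suc i)\<^sup>2 \<noteq> - 1" for i
      using bounds(1)[of i t] by (simp add: algebra_simps)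
  qed
  then show ?thesis by (simp add: algebra_simps)
qed

text \<open>The nonzero limit is what later permits division by it and bounds the inverses.\<close>

lemma q_fact_tendsto:
  fixes q :: real
  assumes q: "\<bar>q\<bar> < 1"
  shows "q_fact q \<longlonglongrightarrow> (\<Prod>i. 1 - q ^ Suc i)" and "(\<Prod>i. 1 - q ^ Suc i) \<noteq> 0"
proof -
  have nz: "1 - q ^ Suc i \<noteq> 0" for i
    using one_minus_power_pos[OF q, of i] by linarith
  have "summable (\<lambda>i. \<bar>q\<bar> * \<bar>q\<bar> ^ i)"
    using q by (intro summable_mult summable_geometric) simp
  then have "summable (\<lambda>i. \<bar>- (q ^ Suc i)\<bar>)"
    by (simp add: abs_mult power_abs)
  then have "convergent_prod (\<lambda>i. 1 + - (q ^ Suc i))"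
    by (rule summable_imp_convergent_prod_real) (use nz in auto)
  then have conv: "convergent_prod (\<lambda>i. 1 - q ^ Suc i)"
    by simp
  then have "(\<lambda>n. q_fact q (Suc n)) \<longlonglongrightarrow> (\<Prod>i. 1 - q ^ Suc i)"
    unfolding q_fact_def lessThan_Suc_atMost by (rule convergent_prod_LIMSEQ)
  then show "q_fact q \<longlonglongrightarrow> (\<Prod>i. 1 - q ^ Suc i)"
    by (rule LIMSEQ_imp_Suc)
  show "(\<Prod>i. 1 - q ^ Suc i) \<noteq> 0"
    using conv nz by (rule prodinf_nonzero)
qed

lemma central_q_binomial_tendsto:
  fixes q :: real
  assumes q: "\<bar>q\<bar> < 1"
  shows "(\<lambda>n. central_q_binomial q n k) \<longlonglongrightarrow> 1 / (\<Prod>i. 1 - q ^ Suc i)"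
proof -
  define L where "L = (\<Prod>i. 1 - q ^ Suc i)"
  note L = q_fact_tendsto[OF q, folded L_def]
  have "(\<lambda>n. q_fact q (2 * n + 1) / (q_fact q (n - k) * q_fact q (n + k + 1))) \<longlonglongrightarrow> L / (L * L)"
    using L(2)
    by (intro tendsto_intros filterlim_compose[OF L(1)] filterlim_subseq filterlim_minus_const_nat_at_top)
      (auto simp: strict_mono_def)
  moreover have "\<forall>\<^sub>F n in sequentially.
      q_fact q (2 * n + 1) / (q_fact q (n - k) * q_fact q (n + k + 1)) = central_q_binomial q n k"
    using eventually_ge_at_top[of k] by eventually_elim (simp add: central_q_binomial_def)
  ultimately have "(\<lambda>n. central_q_binomial q n k) \<longlonglongrightarrow> L / (L * L)"
    by (rule Lim_transform_eventually)
  then show ?thesis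
    using L(2) unfolding L_def[symmetric] by simp
qed

text \<open>Since \<open>q_fact q\<close> converges to a nonzero limit, it and its inverse are both
  bounded; this gives one M for all n and k, as Tannery's theorem requires.\<close>

lemma central_q_binomial_bounded:
  fixes q :: real
  assumes q: "\<bar>q\<bar> < 1"
  obtains M where "\<And>n k. \<bar>central_q_binomial q n k\<bar> \<le> M"
proof -
  note L = q_fact_tendsto[OF q]
  have "Bseq (q_fact q)"
    using L(1) by (intro convergent_imp_Bseq convergentI)
  then obtain A where A: "A > 0" "\<And>n. \<bar>q_fact q n\<bar> \<le> A"
    by (auto elim: BseqE)
  have "Bseq (\<lambda>n. inverse (q_fact q n))"
    using tendsto_inverse[OF L] by (intro convergent_imp_Bseq convergentI)
  then obtain B where B: "B > 0" "\<And>n. \<bar>inverse (q_fact q n)\<bar> \<le> B"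
    by (auto elim: BseqE)
  show ?thesis
  proof
    fix n k
    have "\<bar>q_fact q (2 * n + 1) * (inverse (q_fact q (n - k)) * inverse (q_fact q (n + k + 1)))\<bar>
        \<le> A * (B * B)"
      unfolding abs_mult using A B by (intro mult_mono) (auto simp del: abs_inverse)
    then show "\<bar>central_q_binomial q n k\<bar> \<le> A * (B * B)"
      using A(1) B(1) unfolding central_q_binomial_def
      by (simp add: divide_inverse del: abs_inverse)
  qed
qed

text \<open>This linear lower bound on a quadratic exponent is enough to make a geometric series the
  majorant.\<close>

lemma le_Suc_choose_two: "k \<le> Suc k choose 2"
  by (induction k) (auto simp: Suc_choose_two)

lemma abs_power_choose_le:
  fixes q :: real
  assumes "\<bar>q\<bar> < 1"
  shows "\<bar>q ^ (Suc k choose 2)\<bar> \<le> \<bar>q\<bar> ^ k"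
  using assms power_decreasing[OF le_Suc_choose_two[of k], of "\<bar>q\<bar>"] by (simp add: power_abs)

lemma jacobi_triple_product_sin:
  fixes q t :: real
  assumes q: "\<bar>q\<bar> < 1"
  shows "sin t * (\<Prod>i. 1 - 2 * q ^ Suc i * cos (2 * t) + (q ^ Suc i)\<^sup>2) * (\<Prod>i. 1 - q ^ Suc i) =
    (\<Sum>k. (-1) ^ k * q ^ (Suc k choose 2) * sin ((2 * real k + 1) * t))"
proof -
  define L where "L = (\<Prod>i. 1 - q ^ Suc i)"
  define h where "h i = 1 - 2 * q ^ Suc i * cos (2 * t) + (q ^ Suc i)\<^sup>2" for i
  define w where "w k = (-1) ^ k * q ^ (Suc k choose 2) * sin ((2 * real k + 1) * t)" for k
  have L: "L \<noteq> 0"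
    using q_fact_tendsto(2)[OF q] by (simp add: L_def)
  obtain M where M: "\<And>n k. \<bar>central_q_binomial q n k\<bar> \<le> M"
    using central_q_binomial_bounded[OF q] by blast
  have M0: "0 \<le> M"
    using M[of 0 0] by linarith
  have w_le: "\<bar>w k\<bar> \<le> \<bar>q\<bar> ^ k" for k
  proof -
    have "\<bar>w k\<bar> \<le> \<bar>q\<bar> ^ k * 1"
      unfolding w_def abs_mult using abs_power_choose_le[OF q, of k]
      by (intro mult_mono) (auto simp: power_abs)
    then show ?thesis by simp
  qed
  have sum_geo: "summable (\<lambda>k. \<bar>q\<bar> ^ k)"
    using q by (intro summable_geometric) simp
  have lim_sum: "((\<lambda>n. \<Sum>k. w k * central_q_binomial q n k) \<longlongrightarrow> (\<Sum>k. w k * (1 / L))) sequentially"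
  proof (rule tannerys_theorem[THEN conjunct2, THEN conjunct2])
    show "((\<lambda>n. w k * central_q_binomial q n k) \<longlongrightarrow> w k * (1 / L)) sequentially" for k
      unfolding L_def by (intro tendsto_intros central_q_binomial_tendsto q)
    have "norm (w k * central_q_binomial q n k) \<le> \<bar>q\<bar> ^ k * M" for k n
      unfolding real_norm_def abs_mult using w_le M M0 by (intro mult_mono) auto
    then show "\<forall>\<^sub>F (k, n) in sequentially \<times>\<^sub>F sequentially.
        norm (w k * central_q_binomial q n k) \<le> \<bar>q\<bar> ^ k * M"
      by (intro always_eventually) auto
    show "summable (\<lambda>k. \<bar>q\<bar> ^ k * M)"
      using sum_geo by (rule summable_mult2)
  qed simp
  have finite_eq: "(\<lambda>n. \<Sum>k. w k * central_q_binomial q n k) = (\<lambda>n. sin t * (\<Prod>i<n. h i))"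
  proof
    fix n
    \<comment> \<open>The default value 0 for k > n makes the finite sum a full series, the form to
      which Tannery's theorem applies.\<close>
    have "(\<Sum>k. w k * central_q_binomial q n k) = (\<Sum>k\<le>n. w k * central_q_binomial q n k)"
      by (rule suminf_finite) (auto simp: central_q_binomial_def)
    then show "(\<Sum>k. w k * central_q_binomial q n k) = sin t * (\<Prod>i<n. h i)"
      unfolding h_def finite_triple_product[OF q] w_def by (simp add: mult_ac)
  qed
  have "(\<lambda>n. \<Prod>i<n. h i) \<longlonglongrightarrow> prodinf h"
    using convergent_prod_LIMSEQ[OF convergent_prod_theta[OF q, of t]]
    unfolding h_def[symmetric] lessThan_Suc_atMost[symmetric] by (rule LIMSEQ_imp_Suc)
  then have lim_prod: "(\<lambda>n. sin t * (\<Prod>i<n. h i)) \<longlonglongrightarrow> sin t * prodinf h"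
    by (intro tendsto_intros)
  have "sin t * prodinf h = (\<Sum>k. w k * (1 / L))"
    using lim_prod lim_sum[unfolded finite_eq] by (rule LIMSEQ_unique)
  also have "\<dots> = (\<Sum>k. w k) * (1 / L)"
  proof (rule suminf_mult2[symmetric])
    show "summable w"
      using sum_geo by (rule summable_comparison_test[rotated]) (use w_le in auto)
  qed
  finally have "sin t * prodinf h * L = (\<Sum>k. w k)"
    using L by simp
  then show ?thesis by (simp add: h_def[abs_def] L_def w_def)
qed

section \<open>Growth of the Chebyshev values and summability\<close>

lemma poly_cheb_U_rec_one: "poly (cheb_U_rec n) 1 = real n + 1"
  and poly_cheb_U_rec_minus_one: "poly (cheb_U_rec n) (-1) = (-1) ^ n * (real n + 1)"
  by (induction n rule: cheb_U_rec.induct) (auto simp: algebra_simps)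

text \<open>C may depend on y. Inside the interval the sine quotient gives 1 / |sin t|; at y = 1 and
  y = -1 that quotient is 0/0, so the values come from the recurrence.\<close>

lemma cheb_U_bound:
  assumes "\<bar>y\<bar> \<le> 1"
  obtains C where "\<And>n. \<bar>poly (cheb_U n) y\<bar> \<le> C * (real n + 1)"
proof (cases "\<bar>y\<bar> = 1")
  case True
  then have "y = 1 \<or> y = - 1" by linarith
  then have "\<bar>poly (cheb_U n) y\<bar> \<le> 1 * (real n + 1)" for n
    by (auto simp: cheb_U_eq_rec poly_cheb_U_rec_one poly_cheb_U_rec_minus_one abs_mult)
  then show ?thesis by (rule that)
next
  case False
  define t where "t = arccos y"
  have t: "y = cos t"
    using assms by (simp add: t_def cos_arccos_abs)
  have "y\<^sup>2 < 1"
    using False assms by (simp add: abs_square_less_1)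
  then have s: "sin t \<noteq> 0"
    by (simp add: t_def sin_arccos_abs assms)
  have "\<bar>poly (cheb_U n) y\<bar> \<le> (1 / \<bar>sin t\<bar>) * (real n + 1)" for n
  proof -
    have "\<bar>poly (cheb_U n) y\<bar> = (1 / \<bar>sin t\<bar>) * \<bar>sin ((real n + 1) * t)\<bar>"
      by (simp add: t cheb_U_cos[OF s])
    also have "\<dots> \<le> (1 / \<bar>sin t\<bar>) * (real n + 1)"
      by (intro mult_left_mono order_trans[OF abs_sin_le_one]) auto
    finally show ?thesis .
  qed
  then show ?thesis by (rule that)
qed

text \<open>Linear growth against geometric decay: the majorant is a multiple of the differentiated
  geometric series.\<close>

lemma summable_theta_cheb_U:
  fixes q y :: real
  assumes q: "\<bar>q\<bar> < 1" and y: "\<bar>y\<bar> \<le> 1"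
  shows "summable (\<lambda>k. (-1) ^ k * q ^ (Suc k choose 2) * poly (cheb_U (2 * k)) y)"
proof -
  obtain C where C: "\<And>n. \<bar>poly (cheb_U n) y\<bar> \<le> C * (real n + 1)"
    using cheb_U_bound[OF y] by blast
  have C0: "0 \<le> C"
    using C[of 0] by simp
  have "summable (\<lambda>k. real (Suc k) * \<bar>q\<bar> ^ k)"
    using geometric_deriv_sums[of "\<bar>q\<bar>"] q by (simp add: sums_iff)
  then have "summable (\<lambda>k. 2 * C * (real (Suc k) * \<bar>q\<bar> ^ k))"
    by (rule summable_mult)
  then show ?thesis
  proof (rule summable_comparison_test[rotated], intro exI allI impI)
    fix k
    have "\<bar>poly (cheb_U (2 * k)) y\<bar> \<le> C * (2 * real (Suc k))"
      using C[of "2 * k"] C0 by (elim order_trans) (auto intro!: mult_left_mono)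
    then have "\<bar>q ^ (Suc k choose 2)\<bar> * \<bar>poly (cheb_U (2 * k)) y\<bar> \<le> \<bar>q\<bar> ^ k * (C * (2 * real (Suc k)))"
      using abs_power_choose_le[OF q, of k] by (intro mult_mono) auto
    then show "norm ((-1) ^ k * q ^ (Suc k choose 2) * poly (cheb_U (2 * k)) y)
        \<le> 2 * C * (real (Suc k) * \<bar>q\<bar> ^ k)"
      by (simp add: abs_mult power_abs algebra_simps)
  qed
qed

section \<open>From the density to the theta product\<close>

lemma prodinf_q_gaussian:
  fixes q t :: real
  assumes q: "\<bar>q\<bar> < 1" and x: "(1 - q) * x\<^sup>2 = 4 * (cos t)\<^sup>2"
  shows "(\<Prod>k. (1 + q ^ k)\<^sup>2 - (1 - q) * x\<^sup>2 * q ^ k) =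
    4 * (sin t)\<^sup>2 * (\<Prod>i. 1 - 2 * q ^ Suc i * cos (2 * t) + (q ^ Suc i)\<^sup>2)"
proof -
  define f where "f k = (1 + q ^ k)\<^sup>2 - (1 - q) * x\<^sup>2 * q ^ k" for k
  \<comment> \<open>Here 2 - 4 cos(t)^2 = -2 cos(2t). The factor at k = 0 is split off because it
    becomes 4 sin(t)^2.\<close>
  have f_Suc: "f (i + 1) = 1 - 2 * q ^ Suc i * cos (2 * t) + (q ^ Suc i)\<^sup>2" for i
    unfolding f_def x cos_double_cos by (simp add: algebra_simps power2_eq_square)
  have "f 0 = 4 * (sin t)\<^sup>2"
    unfolding f_def x sin_squared_eq by simp
  moreover have "convergent_prod f"
    using convergent_prod_theta[OF q, of t] unfolding f_Suc[symmetric]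
    by (rule convergent_prod_offset)
  then have "prodinf f = f 0 * (\<Prod>i. f (i + 1))"
    using has_prod_ignore_initial_segment'[of f 1] by (simp add: has_prod_iff)
  ultimately show ?thesis
    unfolding f_Suc by (simp add: f_def[abs_def])
qed

theorem theorem1:
  fixes q x :: real
  assumes "\<bar>q\<bar> < 1" and "\<bar>x\<bar> \<le> 2 / sqrt (1 - q)"
  shows "summable (\<lambda>k. (-1) ^ k * q ^ (Suc k choose 2)
                        * poly (cheb_U (2 * k)) (x * sqrt (1 - q) / 2)) \<and>
         q_gaussian_density q x =
           sqrt (1 - q) / (2 * pi) * sqrt (4 - (1 - q) * x\<^sup>2)
           * (\<Sum>k. (-1) ^ k * q ^ (Suc k choose 2)
                   * poly (cheb_U (2 * k)) (x * sqrt (1 - q) / 2))"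
proof -
  define y where "y = x * sqrt (1 - q) / 2"
  have q1: "0 < 1 - q"
    using assms(1) by linarith
  have y1: "\<bar>y\<bar> \<le> 1"
    using assms(2) q1 by (simp add: y_def abs_mult field_simps)
  define t where "t = arccos y"
  \<comment> \<open>The range of arccos makes sin t nonnegative, so the square root below is 2 sin t
    without an absolute value.\<close>
  have t: "y = cos t" "0 \<le> sin t"
    using y1 by (simp_all add: t_def cos_arccos_abs sin_arccos_abs abs_square_le_1)
  have x: "(1 - q) * x\<^sup>2 = 4 * (cos t)\<^sup>2"
    using q1 by (simp add: y_def power_mult_distrib power_divide flip: t(1))
  have root: "sqrt (4 - (1 - q) * x\<^sup>2) = 2 * sin t"
    by (rule real_sqrt_unique) (use t in \<open>simp_all add: x power_mult_distrib sin_squared_eq\<close>)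
  \<comment> \<open>Summation starts at 0, so k - 1 of the usual formula is k here: the exponent is
    \<open>Suc k choose 2\<close> and the degree 2k.\<close>
  define S where "S = (\<Sum>k. (-1) ^ k * q ^ (Suc k choose 2) * poly (cheb_U (2 * k)) y)"
  have sm: "summable (\<lambda>k. (-1) ^ k * q ^ (Suc k choose 2) * poly (cheb_U (2 * k)) y)"
    using assms(1) y1 by (rule summable_theta_cheb_U)
  have in_iff: "\<bar>x\<bar> < 2 / sqrt (1 - q) \<longleftrightarrow> sin t \<noteq> 0"
  proof -
    have "\<bar>x\<bar> < 2 / sqrt (1 - q) \<longleftrightarrow> \<bar>y\<bar> < 1"
      using q1 by (simp add: y_def abs_mult field_simps)
    also have "\<dots> \<longleftrightarrow> (cos t)\<^sup>2 < 1"
      by (simp add: t abs_square_less_1)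
    also have "\<dots> \<longleftrightarrow> sin t \<noteq> 0"
      using sin_squared_eq[of t] zero_less_power2[of "sin t"] by simp
    finally show ?thesis .
  qed
  have "q_gaussian_density q x = sqrt (1 - q) / (2 * pi) * (2 * sin t) * S"
  proof (cases "sin t = 0")
    \<comment> \<open>At the endpoints the density is 0 by its \<open>else\<close> branch, and the
      right side by its factor sin t.\<close>
    case True
    then show ?thesis by (simp add: q_gaussian_density_def in_iff)
  next
    case False
    have "sin t * S = (\<Sum>k. sin t * ((-1) ^ k * q ^ (Suc k choose 2) * poly (cheb_U (2 * k)) y))"
      unfolding S_def using sm by (rule suminf_mult[symmetric])
    also have "\<dots> = (\<Sum>k. (-1) ^ k * q ^ (Suc k choose 2) * sin ((2 * real k + 1) * t))"
      using False by (simp add: t cheb_U_cos)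
    also note jacobi_triple_product_sin[OF assms(1), symmetric]
    finally have "S = (\<Prod>i. 1 - 2 * q ^ Suc i * cos (2 * t) + (q ^ Suc i)\<^sup>2) * (\<Prod>i. 1 - q ^ Suc i)"
      using False by (simp only: mult.assoc mult_cancel_left simp_thms)
    \<comment> \<open>The 4 sin(t)^2 from the factor at k = 0, divided by the root 2 sin t, leaves 2
      sin t in the numerator.\<close>
    moreover have "sqrt (1 - q) / (2 * pi * (2 * sin t)) * (4 * (sin t)\<^sup>2 * A) * B =
        sqrt (1 - q) / (2 * pi) * (2 * sin t) * (A * B)" for A B
      using False by (simp add: power2_eq_square)
    ultimately show ?thesis
      unfolding q_gaussian_density_def in_iff root prodinf_q_gaussian[OF assms(1) x]
        Suc_eq_plus1[symmetric]
      using False by (simp only: if_True simp_thms)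
  qed
  then show ?thesis
    using sm unfolding root y_def[symmetric] S_def by blast
qed

end
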